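(* Let $\alpha\in(0,2)$. Let $X_1,X_2,\dots$ be independent identically distributed real random variables, and for each natural $n$ let $S_n:=\sum_{i=1}^n X_i$. Suppose that the distribution of $X_1$ is symmetric about $0$ and has a probability density function $f$ such that $$f(u)\asymp u^{-1-\alpha}\quad\text{as } u\to\infty.$$ Then $$\mathsf P(S_n>x)\sim \mathsf P\Big(S_n>x,\ \bigcup_{i\in[n]}\big\{X_i>x,\ |S_n-X_i|\le bx,\ \max_{j\in[n]\setminus\{i\}}|X_j|\le cx\big\}\Big)$$ whenever $n\in\mathbb N$, $x\in(0,\infty)$, $c\in(0,1)$, and $b\in(0,1)$ vary in such a way that $$n<<x^{\alpha},\qquad nx^{-\alpha}<<c^{2\alpha},\qquad nx^{-\alpha}<<b^2c^{\alpha-2}.$$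
   Context: $\mathbb N=\{1,2,\dots\}$ and $[n]:=\{1,\dots,n\}$. The number $\alpha$ and the distribution of $X_1$ are fixed, while $n,x,c,b$ vary; that is, one considers an arbitrary sequence of quadruples $(n,x,c,b)=(n_k,x_k,c_k,b_k)$, $k\to\infty$, and all limits are taken along this sequence (it is not required that $n\to\infty$; $n$ may be fixed). For positive expressions $E$ and $F$ in terms of $x,n,c,b$: $E\sim F$ means $E/F\to1$; $E<<F$ means $E=o(F)$, i.e. $E/F\to0$; $E\asymp F$ means that both $\limsup E/F<\infty$ and $\limsup F/E<\infty$. In the condition on $f$, the relation $\asymp$ is understood in the same way with the limit superior taken as $u\to\infty$. The event "$S_n>x,\ \bigcup_i\{\dots\}$" is the intersection of $\{S_n>x\}$ with the union. The maximum over an empty index set (when $n=1$) is taken to be $0$. *)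

theory Defs
  imports "HOL-Probability.Probability" "HOL-Library.Landau_Symbols"
begin

definition partial_sum :: "(nat \<Rightarrow> 'a \<Rightarrow> real) \<Rightarrow> nat \<Rightarrow> 'a \<Rightarrow> real" where
  "partial_sum X n \<omega> = (\<Sum>i\<in>{1..n}. X i \<omega>)"

(* Only the case n = 1 of the event below makes use of the value at the empty set. *)
definition max_or_zero :: "real set \<Rightarrow> real" where
  "max_or_zero A = (if A = {} then 0 else Max A)"

definition one_big_jump ::
  "'a measure \<Rightarrow> (nat \<Rightarrow> 'a \<Rightarrow> real) \<Rightarrow> nat \<Rightarrow> real \<Rightarrow> real \<Rightarrow> real \<Rightarrow> nat \<Rightarrow> 'a set" where
  "one_big_jump M X n x c b i =
     {\<omega> \<in> space M. X i \<omega> > x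
        \<and> \<bar>partial_sum X n \<omega> - X i \<omega>\<bar> \<le> b * x
        \<and> max_or_zero ((\<lambda>j. \<bar>X j \<omega>\<bar>) ` ({1..n} - {i})) \<le> c * x}"

end

theory Submission
  imports Defs
begin

text \<open>
  Put \<open>r = n x\<^bsup>-\<alpha>\<^esup>\<close>, which tends to \<open>0\<close>. The density makes \<open>P(X\<^sub>1 > x)\<close> of order \<open>x\<^bsup>-\<alpha>\<^esup>\<close>,
  and \<open>P(S\<^sub>n > x)\<close> is at least of order \<open>r\<close>: with probability of that order one summand exceeds
  \<open>2x\<close> while the others, with high probability, stay below \<open>2x\<close> and sum to less than \<open>x\<close>
  (lemma \<open>prob_sum_gt_ge\<close>). It therefore suffices that the event \<open>S\<^sub>n > x\<close> without a big
  jump of the prescribed kind has probability \<open>o(r)\<close>.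

  The main tool for this is Chebyshev's inequality for truncated sums. By symmetry, truncating a
  summand at a level \<open>t\<close> keeps its mean \<open>0\<close>, and since \<open>\<alpha> < 2\<close> its second moment is at most
  \<open>V t\<^bsup>2-\<alpha>\<^esup>\<close>. Hence a sum of at most \<open>n\<close> truncated summands exceeds \<open>y\<close> in absolute value
  with probability at most \<open>n V t\<^bsup>2-\<alpha>\<^esup> / y\<^sup>2\<close>, and it is independent of the remaining
  summand. Take \<open>t = m x\<close> with \<open>m = min c \<eta>\<close>; the extra constant \<open>\<eta>\<close> is there because \<open>c\<close>
  itself need not become small. If \<open>S\<^sub>n > x\<close> and no big jump occurs, then one of the following
  happens (lemma \<open>prob_sum_gt_le_big_jump\<close>).

  \<^item> Two summands exceed \<open>t\<close> in absolute value: probability of order \<open>r\<^sup>2 m\<^bsup>-2\<alpha>\<^esup>\<close>, which is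
    \<open>o(r)\<close> since \<open>r << c\<^bsup>2\<alpha>\<^esup>\<close> and, for fixed \<open>\<eta>\<close>, also \<open>r << \<eta>\<^bsup>2\<alpha>\<^esup>\<close>.
  \<^item> No summand exceeds \<open>t\<close>: order \<open>r m\<^bsup>2-\<alpha>\<^esup>\<close>, a small multiple of \<open>r\<close> for small \<open>\<eta>\<close>.
  \<^item> Exactly one summand \<open>X\<^sub>i\<close> exceeds \<open>t\<close>, but \<open>X\<^sub>i \<le> (1 - \<delta>) x\<close>, so that the others sum to
    more than \<open>\<delta> x\<close>: order \<open>r\<^sup>2 m\<^bsup>2-2\<alpha>\<^esup> / \<delta>\<^sup>2\<close>, negligible like the first case.
  \<^item> Some \<open>X\<^sub>i\<close> lies in the window \<open>((1 - \<delta>) x, x]\<close>: order \<open>\<delta> r\<close>. This is where a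
    density is used, since a two-sided bound on the tail alone would allow atoms just below \<open>x\<close>.
  \<^item> \<open>X\<^sub>i > x\<close> and the others stay below \<open>t \<le> c x\<close>, but sum to more than \<open>b x\<close> in absolute
    value: order \<open>r\<^sup>2 m\<^bsup>2-\<alpha>\<^esup> / b\<^sup>2\<close>, which is \<open>o(r)\<close> by the last hypothesis.

  All limits are taken for fixed \<open>\<delta>\<close> and \<open>\<eta>\<close>, which are then made small.
\<close>

section \<open>Densities comparable to a power\<close>

lemma nn_integral_power_tail:
  fixes a t :: real
  assumes "0 < a" "0 < t"
  shows "(\<integral>\<^sup>+u. ennreal (u powr (- 1 - a)) * indicator {t..} u \<partial>lborel)
           = ennreal (t powr (- a) / a)"
proof -
  have "(\<integral>\<^sup>+u. ennreal (u powr (- 1 - a)) * indicator {t..} u \<partial>lborel)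
          = ennreal (0 - (- (t powr (- a) / a)))"
  proof (rule nn_integral_FTC_atLeast)
    show "((\<lambda>u. - (u powr (- a) / a)) has_real_derivative u powr (- 1 - a)) (at u)" if "t \<le> u" for u
      using that assms by (auto intro!: derivative_eq_intros simp: minus_diff_commute)
    have "((\<lambda>u::real. u powr (- a)) \<longlongrightarrow> 0) at_top"
      using assms by (intro tendsto_neg_powr filterlim_ident) auto
    from tendsto_minus[OF tendsto_divide[OF this tendsto_const[of a]]]
    show "((\<lambda>u. - (u powr (- a) / a)) \<longlongrightarrow> 0) at_top"
      using assms by simp
  qed auto
  then show ?thesis by simp
qed

context prob_space
begin

lemma prob_tail_le_of_density_le:
  assumes X: "distributed M lborel X (\<lambda>u. ennreal (f u))"
    and f: "\<And>u. u\<^sub>0 \<le> u \<Longrightarrow> f u \<le> B * u powr (- 1 - a)"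
    and "0 < a" "0 \<le> B" "0 < u\<^sub>0" "u\<^sub>0 \<le> t"
  shows "prob {\<omega>\<in>space M. t \<le> X \<omega>} \<le> B / a * t powr (- a)"
proof -
  have "emeasure M (X -` {t..} \<inter> space M) = (\<integral>\<^sup>+u. ennreal (f u) * indicator {t..} u \<partial>lborel)"
    by (rule distributed_emeasure[OF X]) auto
  also have "\<dots> \<le> (\<integral>\<^sup>+u. ennreal B * (ennreal (u powr (- 1 - a)) * indicator {t..} u) \<partial>lborel)"
    using f assms(4,6)
    by (intro nn_integral_mono) (auto simp: ennreal_mult[symmetric] intro!: ennreal_leI split: split_indicator)
  also have "\<dots> = ennreal B * (\<integral>\<^sup>+u. ennreal (u powr (- 1 - a)) * indicator {t..} u \<partial>lborel)"
    by (rule nn_integral_cmult) auto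
  also have "\<dots> = ennreal (B / a * t powr (- a))"
    using assms by (subst nn_integral_power_tail) (auto simp: ennreal_mult[symmetric])
  finally have "emeasure M (X -` {t..} \<inter> space M) \<le> ennreal (B / a * t powr (- a))" .
  moreover have "{\<omega>\<in>space M. t \<le> X \<omega>} = X -` {t..} \<inter> space M" by auto
  ultimately show ?thesis
    using assms by (auto simp: emeasure_eq_measure ennreal_le_iff)
qed

lemma prob_tail_ge_of_density_ge:
  assumes X: "distributed M lborel X (\<lambda>u. ennreal (f u))"
    and f: "\<And>u. u\<^sub>0 \<le> u \<Longrightarrow> A * u powr (- 1 - a) \<le> f u"
    and "0 < a" "0 \<le> A" "0 < u\<^sub>0" "u\<^sub>0 \<le> t"
  shows "A / a * t powr (- a) \<le> prob {\<omega>\<in>space M. t \<le> X \<omega>}"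
proof -
  have "ennreal (A / a * t powr (- a))
      = ennreal A * (\<integral>\<^sup>+u. ennreal (u powr (- 1 - a)) * indicator {t..} u \<partial>lborel)"
    using assms by (subst nn_integral_power_tail) (auto simp: ennreal_mult[symmetric])
  also have "\<dots> = (\<integral>\<^sup>+u. ennreal A * (ennreal (u powr (- 1 - a)) * indicator {t..} u) \<partial>lborel)"
    by (rule nn_integral_cmult[symmetric]) auto
  also have "\<dots> \<le> (\<integral>\<^sup>+u. ennreal (f u) * indicator {t..} u \<partial>lborel)"
    using f assms(4,6)
    by (intro nn_integral_mono) (auto simp: ennreal_mult[symmetric] intro!: ennreal_leI split: split_indicator)
  also have "\<dots> = emeasure M (X -` {t..} \<inter> space M)"
    by (rule distributed_emeasure[OF X, symmetric]) auto
  finally have "ennreal (A / a * t powr (- a)) \<le> emeasure M (X -` {t..} \<inter> space M)" .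
  moreover have "{\<omega>\<in>space M. t \<le> X \<omega>} = X -` {t..} \<inter> space M" by auto
  ultimately show ?thesis
    using assms by (auto simp: emeasure_eq_measure ennreal_le_iff)
qed

text \<open>
  The restriction \<open>\<delta> \<le> 1 / 2\<close> keeps the window above \<open>x / 2\<close>, where the density is at most
  \<open>B (x / 2)\<^bsup>-1-a\<^esup>\<close>; the bound is this value times the length \<open>\<delta> x\<close> of the window.
\<close>

lemma prob_window_le_of_density_le:
  assumes X: "distributed M lborel X (\<lambda>u. ennreal (f u))"
    and f: "\<And>u. u\<^sub>0 \<le> u \<Longrightarrow> f u \<le> B * u powr (- 1 - a)"
    and "0 < a" "0 \<le> B" "0 < u\<^sub>0" "2 * u\<^sub>0 \<le> x" "0 < \<delta>" "\<delta> \<le> 1 / 2"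
  shows "prob {\<omega>\<in>space M. (1 - \<delta>) * x < X \<omega> \<and> X \<omega> \<le> x} \<le> B * 2 powr (1 + a) * \<delta> * x powr (- a)"
proof -
  have half: "x / 2 \<le> (1 - \<delta>) * x"
    using assms mult_right_mono[of "1/2" "1 - \<delta>" x] by simp
  have dens: "f u \<le> B * (x / 2) powr (- 1 - a)" if "(1 - \<delta>) * x < u" for u
  proof -
    have "f u \<le> B * u powr (- 1 - a)" using half that assms by (intro f) linarith
    also have "\<dots> \<le> B * (x / 2) powr (- 1 - a)"
      using half that assms by (intro mult_left_mono powr_mono2') linarith+
    finally show ?thesis .
  qed
  have "emeasure M (X -` {(1 - \<delta>) * x<..x} \<inter> space M)
      = (\<integral>\<^sup>+u. ennreal (f u) * indicator {(1 - \<delta>) * x<..x} u \<partial>lborel)"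
    by (rule distributed_emeasure[OF X]) auto
  also have "\<dots> \<le> (\<integral>\<^sup>+u. ennreal (B * (x / 2) powr (- 1 - a)) * indicator {(1 - \<delta>) * x<..x} u \<partial>lborel)"
    using dens by (intro nn_integral_mono) (auto intro!: ennreal_leI split: split_indicator)
  also have "\<dots> = ennreal (B * (x / 2) powr (- 1 - a)) * ennreal (\<delta> * x)"
    using assms half by (subst nn_integral_cmult_indicator) (auto simp: algebra_simps)
  also have "\<dots> = ennreal (B * 2 powr (1 + a) * \<delta> * x powr (- a))"
  proof -
    have "x powr (- a) = x * x powr (- 1 - a)"
      using assms by (subst powr_mult_base) auto
    moreover have "2 powr (- 1 - a) = 1 / 2 powr (1 + a)"
      using powr_minus_divide[of 2 "1 + a"] by (simp add: algebra_simps)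
    ultimately have "(x / 2) powr (- 1 - a) * x = 2 powr (1 + a) * x powr (- a)"
      using assms by (simp add: powr_divide)
    then show ?thesis
      using assms by (subst ennreal_mult[symmetric]) (auto simp: ac_simps)
  qed
  finally have "emeasure M (X -` {(1 - \<delta>) * x<..x} \<inter> space M)
      \<le> ennreal (B * 2 powr (1 + a) * \<delta> * x powr (- a))" .
  moreover have "{\<omega>\<in>space M. (1 - \<delta>) * x < X \<omega> \<and> X \<omega> \<le> x} = X -` {(1 - \<delta>) * x<..x} \<inter> space M"
    by auto
  ultimately show ?thesis
    using assms by (auto simp: emeasure_eq_measure ennreal_le_iff)
qed

end

section \<open>Truncated sums\<close>

definition truncate :: "real \<Rightarrow> real \<Rightarrow> real" where
  "truncate t u = (if \<bar>u\<bar> \<le> t then u else 0)"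

lemma truncate_measurable [measurable]: "truncate t \<in> borel_measurable borel"
  unfolding truncate_def by measurable

lemma abs_truncate_le: "0 \<le> t \<Longrightarrow> \<bar>truncate t u\<bar> \<le> t"
  by (simp add: truncate_def)

lemma truncate_minus: "truncate t (- u) = - truncate t u"
  by (simp add: truncate_def)

context prob_space
begin

text \<open>
  On \<open>\<bar>X\<bar> \<le> t\<close> one has \<open>X\<^sup>2 = \<integral> 2 s ds\<close> over \<open>0 < s < \<bar>X\<bar>\<close>. Exchanging the integrals leaves
  \<open>2 s P(\<bar>X\<bar> > s)\<close>, at most \<open>2 K s\<^bsup>1-a\<^esup>\<close>, and this is integrable at \<open>0\<close> because \<open>a < 2\<close>.
\<close>

lemma truncated_second_moment_le:
  fixes X :: "'a \<Rightarrow> real"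
  assumes [measurable]: "random_variable borel X"
    and tail: "\<And>t. 0 < t \<Longrightarrow> prob {\<omega>\<in>space M. t < \<bar>X \<omega>\<bar>} \<le> K * t powr (- a)"
    and "a < 2" "0 \<le> K" "0 < t"
  shows "expectation (\<lambda>\<omega>. (truncate t (X \<omega>))\<^sup>2) \<le> 2 * K / (2 - a) * t powr (2 - a)"
proof -
  interpret P: pair_sigma_finite M lborel ..
  have sq: "ennreal ((truncate t u)\<^sup>2)
      \<le> (\<integral>\<^sup>+s. ennreal (2 * s) * indicator {0..t} s * indicator {s. s < \<bar>u\<bar>} s \<partial>lborel)" for u
  proof -
    define y where "y = \<bar>truncate t u\<bar>"
    have y: "0 \<le> y" "y \<le> t" "y \<le> \<bar>u\<bar>" using assms by (auto simp: y_def truncate_def)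
    have "ennreal (y\<^sup>2 - 0\<^sup>2) = (\<integral>\<^sup>+s. ennreal (2 * s) * indicator {0..y} s \<partial>lborel)"
      by (rule nn_integral_FTC_Icc[symmetric]) (auto intro!: derivative_eq_intros simp: y)
    also have "\<dots> \<le> (\<integral>\<^sup>+s. ennreal (2 * s) * indicator {0..t} s * indicator {s. s < \<bar>u\<bar>} s \<partial>lborel)"
      using y AE_lborel_singleton[of y]
      by (intro nn_integral_mono_AE) (auto elim!: eventually_mono split: split_indicator)
    finally show ?thesis by (simp add: y_def)
  qed
  have "(\<integral>\<^sup>+\<omega>. ennreal ((truncate t (X \<omega>))\<^sup>2) \<partial>M)
      \<le> (\<integral>\<^sup>+\<omega>. (\<integral>\<^sup>+s. ennreal (2 * s) * indicator {0..t} s * indicator {s. s < \<bar>X \<omega>\<bar>} s \<partial>lborel) \<partial>M)"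
    by (intro nn_integral_mono sq)
  also have "\<dots> = (\<integral>\<^sup>+s. (\<integral>\<^sup>+\<omega>. ennreal (2 * s) * indicator {0..t} s * indicator {s. s < \<bar>X \<omega>\<bar>} s \<partial>M) \<partial>lborel)"
    by (rule P.Fubini'[symmetric]) measurable
  also have "\<dots> \<le> (\<integral>\<^sup>+s. ennreal (2 * K * s powr (1 - a)) * indicator {0..t} s \<partial>lborel)"
  proof (rule nn_integral_mono_AE, rule eventually_mono[OF AE_lborel_singleton[of 0]])
    fix s :: real assume "s \<noteq> 0"
    have "(\<integral>\<^sup>+\<omega>. ennreal (2 * s) * indicator {0..t} s * indicator {s. s < \<bar>X \<omega>\<bar>} s \<partial>M)
        = ennreal (2 * s) * indicator {0..t} s * (\<integral>\<^sup>+\<omega>. indicator {\<omega>\<in>space M. s < \<bar>X \<omega>\<bar>} \<omega> \<partial>M)"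
      by (subst nn_integral_cmult[symmetric])
         (auto intro!: nn_integral_cong split: split_indicator)
    also have "\<dots> = ennreal (2 * s) * indicator {0..t} s * ennreal (prob {\<omega>\<in>space M. s < \<bar>X \<omega>\<bar>})"
      by (simp add: emeasure_eq_measure)
    also have "\<dots> \<le> ennreal (2 * K * s powr (1 - a)) * indicator {0..t} s"
    proof (cases "s \<in> {0..t}")
      case True
      with \<open>s \<noteq> 0\<close> have "0 < s" by simp
      have "2 * s * prob {\<omega>\<in>space M. s < \<bar>X \<omega>\<bar>} \<le> 2 * s * (K * s powr (- a))"
        using \<open>0 < s\<close> by (intro mult_left_mono tail) auto
      also have "\<dots> = 2 * K * s powr (1 - a)"
        using \<open>0 < s\<close> powr_mult_base[of s "- a"] by simp
      finally show ?thesis using True \<open>0 < s\<close>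
        by (auto simp: ennreal_mult[symmetric] intro!: ennreal_leI)
    qed simp
    finally show "(\<integral>\<^sup>+\<omega>. ennreal (2 * s) * indicator {0..t} s * indicator {s. s < \<bar>X \<omega>\<bar>} s \<partial>M)
        \<le> ennreal (2 * K * s powr (1 - a)) * indicator {0..t} s" .
  qed
  also have "\<dots> \<le> ennreal (2 * K / (2 - a) * t powr (2 - a))"
  proof (rule eq_refl, rule nn_integral_has_integral_lebesgue')
    have "((\<lambda>s. s powr (1 - a)) has_integral (t powr (2 - a) / (2 - a))) {0..t}"
      using has_integral_powr_from_0[of "1 - a" t] assms by (simp add: algebra_simps)
    from has_integral_mult_right[OF this, of "2 * K"]
    show "((\<lambda>s. 2 * K * s powr (1 - a)) has_integral (2 * K / (2 - a) * t powr (2 - a))) {0..t}"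
      by simp
  qed (use assms in auto)
  finally have "(\<integral>\<^sup>+\<omega>. ennreal ((truncate t (X \<omega>))\<^sup>2) \<partial>M) \<le> ennreal (2 * K / (2 - a) * t powr (2 - a))" .
  moreover have "integrable M (\<lambda>\<omega>. (truncate t (X \<omega>))\<^sup>2)"
    using assms abs_truncate_le[of t]
    by (intro integrable_const_bound[where B = "t\<^sup>2"]) (auto simp: abs_le_square_iff[symmetric])
  ultimately show ?thesis using assms
    by (subst (asm) nn_integral_eq_integral) (auto simp: ennreal_le_iff)
qed

text \<open>
  Independence and vanishing means remove the cross terms when the square is expanded. The uniform
  bound on the summands only serves to make everything integrable.
\<close>

lemma second_moment_indep_sum_le:
  fixes Y :: "'i \<Rightarrow> 'a \<Rightarrow> real"
  assumes "finite I" "indep_vars (\<lambda>_. borel) Y I"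
    and "\<And>i \<omega>. i \<in> I \<Longrightarrow> \<bar>Y i \<omega>\<bar> \<le> t"
    and "\<And>i. i \<in> I \<Longrightarrow> expectation (Y i) = 0"
    and "\<And>i. i \<in> I \<Longrightarrow> expectation (\<lambda>\<omega>. (Y i \<omega>)\<^sup>2) \<le> v"
  shows "expectation (\<lambda>\<omega>. (\<Sum>i\<in>I. Y i \<omega>)\<^sup>2) \<le> real (card I) * v"
  using assms
proof (induction I rule: finite_induct)
  case empty
  then show ?case by simp
next
  case (insert i I)
  have rv [measurable]: "random_variable borel (Y j)" if "j \<in> insert i I" for j
    using insert.prems(1) that by (auto simp: indep_vars_def)
  define T where "T \<omega> = (\<Sum>j\<in>I. Y j \<omega>)" for \<omega>
  have T [measurable]: "random_variable borel T"
    unfolding T_def by (intro borel_measurable_sum rv) auto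
  have bT: "\<bar>T \<omega>\<bar> \<le> real (card I) * t" for \<omega>
    unfolding T_def using insert.prems(2)
    by (intro order_trans[OF sum_abs] sum_bounded_above) auto
  have bY: "\<bar>Y i \<omega>\<bar> \<le> t" for \<omega> using insert.prems(2) by auto
  have [measurable]: "random_variable borel (Y i)" by (rule rv) simp
  have int: "integrable M (Y i)" "integrable M T" "integrable M (\<lambda>\<omega>. Y i \<omega> * T \<omega>)"
      "integrable M (\<lambda>\<omega>. (Y i \<omega>)\<^sup>2)" "integrable M (\<lambda>\<omega>. (T \<omega>)\<^sup>2)"
  proof -
    have Y: "norm (Y i \<omega>) \<le> t" and T: "norm (T \<omega>) \<le> real (card I) * t" for \<omega>
      using bY bT by simp_all
    from Y T show "integrable M (Y i)" "integrable M T"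
      by (auto intro!: integrable_const_bound AE_I2)
    have "norm (Y i \<omega> * T \<omega>) \<le> t * (real (card I) * t)" for \<omega>
      unfolding norm_mult by (intro mult_mono Y T order_trans[OF norm_ge_zero Y[of \<omega>]]) simp
    then show "integrable M (\<lambda>\<omega>. Y i \<omega> * T \<omega>)"
      by (auto intro!: integrable_const_bound AE_I2)
    have "norm ((Y i \<omega>)\<^sup>2) \<le> t\<^sup>2" "norm ((T \<omega>)\<^sup>2) \<le> (real (card I) * t)\<^sup>2" for \<omega>
      unfolding norm_power by (intro power_mono Y T norm_ge_zero)+
    then show "integrable M (\<lambda>\<omega>. (Y i \<omega>)\<^sup>2)" "integrable M (\<lambda>\<omega>. (T \<omega>)\<^sup>2)"
      by (auto intro!: integrable_const_bound AE_I2)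
  qed
  have "indep_var borel (Y i) borel T"
    unfolding T_def using insert by (intro indep_vars_sum) auto
  then have "expectation (\<lambda>\<omega>. Y i \<omega> * T \<omega>) = expectation (Y i) * expectation T"
    using int by (intro indep_var_lebesgue_integral) auto
  also have "\<dots> = 0" using insert.prems(3) by simp
  finally have cross: "expectation (\<lambda>\<omega>. Y i \<omega> * T \<omega>) = 0" .
  have "expectation (\<lambda>\<omega>. (\<Sum>j\<in>insert i I. Y j \<omega>)\<^sup>2)
      = expectation (\<lambda>\<omega>. (Y i \<omega>)\<^sup>2 + (T \<omega>)\<^sup>2 + 2 * (Y i \<omega> * T \<omega>))"
    using insert.hyps by (simp add: T_def power2_sum ac_simps)
  also have "\<dots> = expectation (\<lambda>\<omega>. (Y i \<omega>)\<^sup>2) + expectation (\<lambda>\<omega>. (T \<omega>)\<^sup>2)"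
    using int cross by simp
  also have "\<dots> \<le> v + real (card I) * v"
    unfolding T_def using insert by (intro add_mono insert.IH) (auto intro: indep_vars_subset)
  finally show ?case using insert.hyps by (simp add: algebra_simps)
qed

lemma prob_indep_sum_ge_le:
  fixes Y :: "'i \<Rightarrow> 'a \<Rightarrow> real"
  assumes "finite I" and Y: "indep_vars (\<lambda>_. borel) Y I"
    and b: "\<And>i \<omega>. i \<in> I \<Longrightarrow> \<bar>Y i \<omega>\<bar> \<le> t"
    and "\<And>i. i \<in> I \<Longrightarrow> expectation (Y i) = 0"
    and "\<And>i. i \<in> I \<Longrightarrow> expectation (\<lambda>\<omega>. (Y i \<omega>)\<^sup>2) \<le> v" and "0 < y"
  shows "prob {\<omega>\<in>space M. y \<le> \<bar>\<Sum>i\<in>I. Y i \<omega>\<bar>} \<le> real (card I) * v / y\<^sup>2"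
proof -
  have rv: "random_variable borel (Y j)" if "j \<in> I" for j
    using Y that by (auto simp: indep_vars_def)
  have [measurable]: "random_variable borel (\<lambda>\<omega>. \<Sum>i\<in>I. Y i \<omega>)"
    by (intro borel_measurable_sum rv)
  have int: "integrable M (\<lambda>\<omega>. (\<Sum>i\<in>I. Y i \<omega>)\<^sup>2)"
  proof (rule integrable_const_bound[where B = "(real (card I) * t)\<^sup>2"])
    show "AE \<omega> in M. norm ((\<Sum>i\<in>I. Y i \<omega>)\<^sup>2) \<le> (real (card I) * t)\<^sup>2"
    proof (rule AE_I2)
      fix \<omega>
      have "\<bar>\<Sum>i\<in>I. Y i \<omega>\<bar> \<le> real (card I) * t"
        using b by (intro order_trans[OF sum_abs] sum_bounded_above) auto
      then show "norm ((\<Sum>i\<in>I. Y i \<omega>)\<^sup>2) \<le> (real (card I) * t)\<^sup>2"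
        using power_mono[of "\<bar>\<Sum>i\<in>I. Y i \<omega>\<bar>" "real (card I) * t" 2] by simp
    qed
  qed measurable
  have mean: "expectation (\<lambda>\<omega>. \<Sum>i\<in>I. Y i \<omega>) = 0"
    using assms(4) b by (subst Bochner_Integration.integral_sum)
      (auto intro!: integrable_const_bound[where B = t] rv)
  have "prob {\<omega>\<in>space M. y \<le> \<bar>\<Sum>i\<in>I. Y i \<omega>\<bar>} \<le> expectation (\<lambda>\<omega>. (\<Sum>i\<in>I. Y i \<omega>)\<^sup>2) / y\<^sup>2"
    using Chebyshev_inequality[OF _ int \<open>0 < y\<close>] by (simp add: mean)
  also have "\<dots> \<le> real (card I) * v / y\<^sup>2"
    using assms by (intro divide_right_mono second_moment_indep_sum_le) auto
  finally show ?thesis .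
qed

end

section \<open>Sums of independent symmetric variables with a power tail\<close>

text \<open>
  For a bound \<open>y \<ge> 0\<close> the convention for the empty set agrees with the vacuous quantifier, so the
  condition on the maximum becomes one on the single summands.
\<close>

lemma max_or_zero_le_iff:
  assumes "finite A" "0 \<le> y"
  shows "max_or_zero A \<le> y \<longleftrightarrow> (\<forall>a\<in>A. a \<le> y)"
  using assms by (auto simp: max_or_zero_def)

text \<open>
  The distribution enters the estimates for sums only through its symmetry and an upper bound for
  its tail. The bound is required for every \<open>t > 0\<close>, not just for large \<open>t\<close>, which spares
  the truncation estimates a lower limit on the truncation level; it costs only a larger \<open>K\<close>.
\<close>

locale symmetric_power_tail = prob_space M for M :: "'a measure" +
  fixes X :: "nat \<Rightarrow> 'a \<Rightarrow> real" and \<alpha> K :: real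
  assumes alpha: "0 < \<alpha>" "\<alpha> < 2" and K_pos: "0 < K"
    and indep: "indep_vars (\<lambda>_. borel) X {1..}"
    and identical: "\<And>i. 1 \<le> i \<Longrightarrow> distr M borel (X i) = distr M borel (X 1)"
    and symmetric: "distr M borel (\<lambda>\<omega>. - X 1 \<omega>) = distr M borel (X 1)"
    and tail: "\<And>t. 0 < t \<Longrightarrow> prob {\<omega>\<in>space M. t < \<bar>X 1 \<omega>\<bar>} \<le> K * t powr (- \<alpha>)"
begin

text \<open>
  The constant in the bound \<open>V t\<^bsup>2-\<alpha>\<^esup>\<close> for the second moment of a summand truncated at \<open>t\<close>.
\<close>

definition V :: real where "V = 2 * K / (2 - \<alpha>)"

lemma V_pos: "0 < V"
  using alpha K_pos by (simp add: V_def)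

text \<open>
  Truncating the summands one by one keeps them independent and gives them finite moments; where
  none of them exceeds \<open>t\<close> in absolute value, the sum is the untruncated one.
\<close>

abbreviation rest :: "nat \<Rightarrow> real \<Rightarrow> nat \<Rightarrow> 'a \<Rightarrow> real" where
  "rest n t i \<omega> \<equiv> \<Sum>j\<in>{1..n} - {i}. truncate t (X j \<omega>)"

lemma rest_eq:
  assumes "i \<in> {1..n}" "\<And>j. j \<in> {1..n} - {i} \<Longrightarrow> \<bar>X j \<omega>\<bar> \<le> t"
  shows "rest n t i \<omega> = partial_sum X n \<omega> - X i \<omega>"
proof -
  have "rest n t i \<omega> = (\<Sum>j\<in>{1..n} - {i}. X j \<omega>)"
    using assms by (intro sum.cong) (auto simp: truncate_def)
  then show ?thesis
    using assms(1) by (simp add: partial_sum_def sum_diff1)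
qed

lemma X_measurable: "1 \<le> i \<Longrightarrow> random_variable borel (X i)"
  using indep by (auto simp: indep_vars_def)

lemma X1_measurable [measurable]: "random_variable borel (X 1)" "random_variable borel (X (Suc 0))"
  using X_measurable[of 1] by simp_all

lemma prob_X_eq:
  assumes "1 \<le> i" and [measurable]: "A \<in> sets borel"
  shows "prob {\<omega>\<in>space M. X i \<omega> \<in> A} = prob {\<omega>\<in>space M. X 1 \<omega> \<in> A}"
proof -
  have "prob {\<omega>\<in>space M. X i \<omega> \<in> A} = measure (distr M borel (X i)) A"
    using X_measurable[OF assms(1)]
    by (subst measure_distr) (auto intro!: arg_cong[where f = prob])
  also have "\<dots> = measure (distr M borel (X 1)) A"
    by (simp only: identical[OF assms(1)])
  also have "\<dots> = prob {\<omega>\<in>space M. X 1 \<omega> \<in> A}"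
    by (subst measure_distr) (auto intro!: arg_cong[where f = prob])
  finally show ?thesis .
qed

lemma expectation_X_eq:
  assumes "1 \<le> i" and [measurable]: "g \<in> borel_measurable borel"
  shows "expectation (\<lambda>\<omega>. g (X i \<omega>)) = expectation (\<lambda>\<omega>. g (X 1 \<omega>) :: real)"
  using X_measurable[OF assms(1)] identical[OF assms(1)]
    integral_distr[of "X i" M borel g] integral_distr[of "X 1" M borel g] by simp

text \<open>
  Truncation is an odd function, so it preserves symmetry; without symmetry the truncated
  sums would have a drift that Chebyshev's inequality does not control.
\<close>

lemma expectation_truncate_eq_0:
  assumes "1 \<le> i"
  shows "expectation (\<lambda>\<omega>. truncate t (X i \<omega>)) = 0"
proof -
  have "expectation (\<lambda>\<omega>. truncate t (X 1 \<omega>)) = expectation (\<lambda>\<omega>. truncate t (- X 1 \<omega>))"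
    using symmetric integral_distr[of "X 1" M borel "truncate t"]
      integral_distr[of "\<lambda>\<omega>. - X 1 \<omega>" M borel "truncate t"] by simp
  also have "\<dots> = - expectation (\<lambda>\<omega>. truncate t (X 1 \<omega>))"
    by (simp add: truncate_minus)
  finally show ?thesis
    using expectation_X_eq[OF assms, of "truncate t"] by simp
qed

lemma prob_truncated_sum_ge_le:
  assumes "finite I" "I \<subseteq> {1..}" "0 < t" "0 < y"
  shows "prob {\<omega>\<in>space M. y \<le> \<bar>\<Sum>i\<in>I. truncate t (X i \<omega>)\<bar>}
           \<le> real (card I) * (V * t powr (2 - \<alpha>)) / y\<^sup>2"
proof (rule prob_indep_sum_ge_le[OF \<open>finite I\<close>])
  show "indep_vars (\<lambda>_. borel) (\<lambda>i \<omega>. truncate t (X i \<omega>)) I"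
    using assms by (intro indep_vars_compose2[OF indep_vars_subset[OF indep]]) auto
  show "expectation (\<lambda>\<omega>. (truncate t (X i \<omega>))\<^sup>2) \<le> V * t powr (2 - \<alpha>)" if "i \<in> I" for i
    using truncated_second_moment_le[OF X1_measurable(1) tail, of t] that assms alpha K_pos
      expectation_X_eq[of i "\<lambda>u. (truncate t u)\<^sup>2"] by (auto simp: V_def)
qed (use assms abs_truncate_le[of t] expectation_truncate_eq_0 in auto)

lemma prob_rest_ge_le:
  assumes "0 < t" "0 < y"
  shows "prob {\<omega>\<in>space M. y \<le> \<bar>rest n t i \<omega>\<bar>} \<le> real n * (V * t powr (2 - \<alpha>)) / y\<^sup>2"
proof -
  have "prob {\<omega>\<in>space M. y \<le> \<bar>rest n t i \<omega>\<bar>}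
      \<le> real (card ({1..n} - {i})) * (V * t powr (2 - \<alpha>)) / y\<^sup>2"
    using assms by (intro prob_truncated_sum_ge_le) auto
  also have "\<dots> \<le> real n * (V * t powr (2 - \<alpha>)) / y\<^sup>2"
    using V_pos card_mono[of "{1..n}" "{1..n} - {i}"]
    by (intro divide_right_mono mult_right_mono) auto
  finally show ?thesis .
qed

text \<open>
  The single jump \<open>X i\<close> is independent of the truncated rest, so Chebyshev's bound for the rest
  is multiplied by the probability of the jump. This extra factor is what makes an additional
  deviation of the rest negligible next to one jump.
\<close>

lemma prob_jump_rest_le:
  assumes "1 \<le> i" "0 < t" "0 < y" and [measurable]: "A \<in> sets borel"
  shows "prob {\<omega>\<in>space M. X i \<omega> \<in> A \<and> y \<le> \<bar>rest n t i \<omega>\<bar>}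
           \<le> prob {\<omega>\<in>space M. X 1 \<omega> \<in> A} * (real n * (V * t powr (2 - \<alpha>)) / y\<^sup>2)"
proof -
  let ?I = "{1..n} - {i}" and ?g = "\<lambda>j. if j = i then (\<lambda>u. u) else truncate t"
  have "indep_vars (\<lambda>_. borel) (\<lambda>j \<omega>. ?g j (X j \<omega>)) (insert i ?I)"
    using assms by (intro indep_vars_compose2[OF indep_vars_subset[OF indep]]) auto
  from indep_vars_sum[OF _ _ this]
  have "indep_var borel (\<lambda>\<omega>. ?g i (X i \<omega>)) borel (\<lambda>\<omega>. \<Sum>j\<in>?I. ?g j (X j \<omega>))" by simp
  moreover have "(\<lambda>\<omega>. \<Sum>j\<in>?I. ?g j (X j \<omega>)) = rest n t i"
    by (intro ext sum.cong) auto
  ultimately have "indep_var borel (X i) borel (rest n t i)" by simp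
  from indep_varD[OF this, of A "{u. y \<le> \<bar>u\<bar>}"]
  have "prob {\<omega>\<in>space M. X i \<omega> \<in> A \<and> y \<le> \<bar>rest n t i \<omega>\<bar>}
      = prob {\<omega>\<in>space M. X i \<omega> \<in> A} * prob {\<omega>\<in>space M. y \<le> \<bar>rest n t i \<omega>\<bar>}"
    by (simp add: vimage_def Int_def conj_commute)
  also have "\<dots> \<le> prob {\<omega>\<in>space M. X 1 \<omega> \<in> A} * (real n * (V * t powr (2 - \<alpha>)) / y\<^sup>2)"
    unfolding prob_X_eq[OF assms(1,4)] using assms by (intro mult_left_mono prob_rest_ge_le) auto
  finally show ?thesis .
qed

lemma prob_two_jumps_le:
  assumes "1 \<le> i" "1 \<le> j" "i \<noteq> j" "0 < t" and [measurable]: "A \<in> sets borel"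
  shows "prob {\<omega>\<in>space M. X i \<omega> \<in> A \<and> t < \<bar>X j \<omega>\<bar>}
           \<le> prob {\<omega>\<in>space M. X 1 \<omega> \<in> A} * (K * t powr (- \<alpha>))"
proof -
  have "indep_var borel (X i) borel (X j)"
    using indep_vars_sum[of "{j}" i X] indep_vars_subset[OF indep, of "{i, j}"] assms by simp
  from indep_varD[OF this, of A "{u. t < \<bar>u\<bar>}"]
  have "prob {\<omega>\<in>space M. X i \<omega> \<in> A \<and> t < \<bar>X j \<omega>\<bar>}
      = prob {\<omega>\<in>space M. X i \<omega> \<in> A} * prob {\<omega>\<in>space M. t < \<bar>X j \<omega>\<bar>}"
    by (simp add: vimage_def Int_def conj_commute)
  also have "\<dots> = prob {\<omega>\<in>space M. X 1 \<omega> \<in> A} * prob {\<omega>\<in>space M. t < \<bar>X 1 \<omega>\<bar>}"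
    using assms prob_X_eq[of i A] prob_X_eq[of j "{u. t < \<bar>u\<bar>}"] by simp
  also have "\<dots> \<le> prob {\<omega>\<in>space M. X 1 \<omega> \<in> A} * (K * t powr (- \<alpha>))"
    using assms by (intro mult_left_mono tail) auto
  finally show ?thesis .
qed

lemma partial_sum_measurable [measurable]: "random_variable borel (partial_sum X n)"
  unfolding partial_sum_def[abs_def] by (intro borel_measurable_sum X_measurable) simp

lemma one_big_jump_measurable:
  assumes "1 \<le> i" "0 \<le> c * x"
  shows "one_big_jump M X n x c b i \<in> events"
proof -
  have [measurable]: "random_variable borel (X i)" using assms by (intro X_measurable)
  have [measurable]: "{\<omega>\<in>space M. \<bar>X j \<omega>\<bar> \<le> c * x} \<in> events" if "j \<in> {1..n} - {i}" for j
  proof -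
    have [measurable]: "random_variable borel (X j)" using that by (intro X_measurable) auto
    show ?thesis by measurable
  qed
  have [measurable]: "{\<omega>\<in>space M. \<forall>j\<in>{1..n} - {i}. \<bar>X j \<omega>\<bar> \<le> c * x} \<in> events"
    by (intro sets.sets_Collect_finite_All) auto
  have "one_big_jump M X n x c b i
      = {\<omega>\<in>space M. x < X i \<omega> \<and> \<bar>partial_sum X n \<omega> - X i \<omega>\<bar> \<le> b * x}
        \<inter> {\<omega>\<in>space M. \<forall>j\<in>{1..n} - {i}. \<bar>X j \<omega>\<bar> \<le> c * x}"
    using assms by (auto simp: one_big_jump_def max_or_zero_le_iff)
  also have "\<dots> \<in> events" by measurable
  finally show ?thesis .
qed

text \<open>
  The case distinction behind the theorem, according to how many summands exceed the level \<open>t\<close>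
  in absolute value: several (\<open>two\<close>), none (\<open>zero\<close>), or exactly one, which is then at most
  \<open>(1 - \<delta>) x\<close> (\<open>low\<close>), in the window below \<open>x\<close> (\<open>mid\<close>), or above \<open>x\<close>. In the last case
  it is a big jump in the required sense unless the others sum to more than \<open>b x\<close> in absolute value
  (\<open>high\<close>). By \<open>t \<le> c x\<close>, the others then also satisfy the required bound \<open>c x\<close>.
\<close>

lemma prob_sum_gt_le_big_jump:
  fixes n :: nat and x t c b \<delta> :: real
  assumes "0 < x" "0 < t" "t \<le> c * x" "0 < b" "0 < \<delta>"
  defines "q \<equiv> K * t powr (- \<alpha>)" and "v \<equiv> real n * (V * t powr (2 - \<alpha>))"
  shows "prob {\<omega>\<in>space M. x < partial_sum X n \<omega>}
      \<le> prob ({\<omega>\<in>space M. x < partial_sum X n \<omega>} \<inter> (\<Union>i\<in>{1..n}. one_big_jump M X n x c b i))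
        + ((real n * q)\<^sup>2 + v / x\<^sup>2
        + real n * (q * (v / (\<delta> * x)\<^sup>2)
                    + prob {\<omega>\<in>space M. (1 - \<delta>) * x < X 1 \<omega> \<and> X 1 \<omega> \<le> x}
                    + K * x powr (- \<alpha>) * (v / (b * x)\<^sup>2)))"
proof -
  define S where "S = {\<omega>\<in>space M. x < partial_sum X n \<omega>}"
  define G where "G = S \<inter> (\<Union>i\<in>{1..n}. one_big_jump M X n x c b i)"
  define two where "two i j = {\<omega>\<in>space M. X i \<omega> \<in> {u. t < \<bar>u\<bar>} \<and> t < \<bar>X j \<omega>\<bar>}" for i j
  define zero where "zero = {\<omega>\<in>space M. x \<le> \<bar>\<Sum>j\<in>{1..n}. truncate t (X j \<omega>)\<bar>}"
  define low where "low i = {\<omega>\<in>space M. X i \<omega> \<in> {u. t < \<bar>u\<bar>} \<and> \<delta> * x \<le> \<bar>rest n t i \<omega>\<bar>}" for i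
  define mid where "mid i = {\<omega>\<in>space M. X i \<omega> \<in> {(1 - \<delta>) * x<..x}}" for i
  define high where "high i = {\<omega>\<in>space M. X i \<omega> \<in> {x<..} \<and> b * x \<le> \<bar>rest n t i \<omega>\<bar>}" for i
  have [measurable]: "random_variable borel (X j)" if "j \<in> {1..n}" for j
    using that by (intro X_measurable) auto
  have sum_meas [measurable]: "random_variable borel (\<lambda>\<omega>. \<Sum>j\<in>J. truncate t (X j \<omega>))"
    if "J \<subseteq> {1..n}" for J
    using that X_measurable by (intro borel_measurable_sum measurable_compose[OF _ truncate_measurable]) auto
  have ev: "S \<in> events" "G \<in> events" "zero \<in> events"
    unfolding G_def S_def zero_def
    using assms by (auto intro!: sets.Int sets.finite_UN one_big_jump_measurable)
  have ev_i: "low i \<in> events" "mid i \<in> events" "high i \<in> events" if "i \<in> {1..n}" for i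
  proof -
    have [measurable]: "random_variable borel (X i)" "random_variable borel (rest n t i)"
      using that sum_meas by auto
    show "low i \<in> events" "mid i \<in> events" "high i \<in> events"
      unfolding low_def mid_def high_def by measurable
  qed
  have ev_two: "two i j \<in> events" if "i \<in> {1..n}" "j \<in> {1..n} - {i}" for i j
  proof -
    have [measurable]: "random_variable borel (X i)" "random_variable borel (X j)"
      using that by auto
    show ?thesis unfolding two_def by measurable
  qed
  have "S \<subseteq> G \<union> ((\<Union>i\<in>{1..n}. \<Union>j\<in>{1..n} - {i}. two i j) \<union> zero \<union> (\<Union>i\<in>{1..n}. low i \<union> mid i \<union> high i))"
  proof
    fix \<omega> assume \<omega>: "\<omega> \<in> S"
    then have sp: "\<omega> \<in> space M" and gt: "x < partial_sum X n \<omega>" by (auto simp: S_def)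
    consider (none) "\<forall>i\<in>{1..n}. \<bar>X i \<omega>\<bar> \<le> t"
      | (one) i where "i \<in> {1..n}" "t < \<bar>X i \<omega>\<bar>" "\<forall>j\<in>{1..n} - {i}. \<bar>X j \<omega>\<bar> \<le> t"
      | (several) i j where "i \<in> {1..n}" "j \<in> {1..n} - {i}" "t < \<bar>X i \<omega>\<bar>" "t < \<bar>X j \<omega>\<bar>"
      by (meson not_le)
    then show "\<omega> \<in> G \<union> ((\<Union>i\<in>{1..n}. \<Union>j\<in>{1..n} - {i}. two i j) \<union> zero \<union> (\<Union>i\<in>{1..n}. low i \<union> mid i \<union> high i))"
    proof cases
      case none
      then have "(\<Sum>j\<in>{1..n}. truncate t (X j \<omega>)) = partial_sum X n \<omega>"
        unfolding partial_sum_def by (intro sum.cong) (auto simp: truncate_def)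
      then have "\<omega> \<in> zero" using sp gt by (simp add: zero_def)
      then show ?thesis by simp
    next
      case one
      have R: "rest n t i \<omega> = partial_sum X n \<omega> - X i \<omega>"
        using one by (intro rest_eq) auto
      consider "X i \<omega> \<le> (1 - \<delta>) * x" | "(1 - \<delta>) * x < X i \<omega>" "X i \<omega> \<le> x" | "x < X i \<omega>"
        by linarith
      then have "\<omega> \<in> low i \<or> \<omega> \<in> mid i \<or> \<omega> \<in> high i \<or> \<omega> \<in> one_big_jump M X n x c b i"
      proof cases
        case 1
        then have "\<delta> * x \<le> rest n t i \<omega>" using gt R by (simp add: algebra_simps)
        then have "\<delta> * x \<le> \<bar>rest n t i \<omega>\<bar>" by linarith
        then show ?thesis using sp one by (simp add: low_def)
      next
        case 2
        then show ?thesis using sp by (simp add: mid_def)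
      next
        case 3
        have "max_or_zero ((\<lambda>j. \<bar>X j \<omega>\<bar>) ` ({1..n} - {i})) \<le> c * x"
          using one assms by (subst max_or_zero_le_iff) (auto intro: order_trans)
        then show ?thesis using 3 sp R by (auto simp: high_def one_big_jump_def)
      qed
      then show ?thesis using one \<omega> by (auto simp: G_def)
    next
      case several
      then have "\<omega> \<in> two i j" using sp by (simp add: two_def)
      then show ?thesis using several by blast
    qed
  qed
  then have "prob S \<le> prob (G \<union> ((\<Union>i\<in>{1..n}. \<Union>j\<in>{1..n} - {i}. two i j) \<union> zero
      \<union> (\<Union>i\<in>{1..n}. low i \<union> mid i \<union> high i)))"
    using ev ev_i ev_two by (intro finite_measure_mono sets.Un sets.finite_UN) auto
  also have "\<dots> \<le> prob G + (prob (\<Union>i\<in>{1..n}. \<Union>j\<in>{1..n} - {i}. two i j) + prob zero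
      + prob (\<Union>i\<in>{1..n}. low i \<union> mid i \<union> high i))"
    using ev ev_i ev_two
    by (intro order_trans[OF measure_Un_le] add_mono order_refl sets.Un sets.finite_UN) auto
  also have "prob (\<Union>i\<in>{1..n}. \<Union>j\<in>{1..n} - {i}. two i j) \<le> (real n * q)\<^sup>2"
  proof -
    have two_le: "prob (two i j) \<le> q * q" if "i \<in> {1..n}" "j \<in> {1..n} - {i}" for i j
    proof -
      have "prob (two i j) \<le> prob {\<omega>\<in>space M. X 1 \<omega> \<in> {u. t < \<bar>u\<bar>}} * q"
        unfolding two_def q_def using that assms by (intro prob_two_jumps_le) auto
      also have "\<dots> \<le> q * q"
        using tail[OF \<open>0 < t\<close>] K_pos by (intro mult_right_mono) (auto simp: q_def)
      finally show ?thesis .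
    qed
    have "prob (\<Union>i\<in>{1..n}. \<Union>j\<in>{1..n} - {i}. two i j)
        \<le> (\<Sum>i\<in>{1..n}. prob (\<Union>j\<in>{1..n} - {i}. two i j))"
      by (intro finite_measure_subadditive_finite image_subsetI sets.finite_UN ev_two) auto
    also have "\<dots> \<le> (\<Sum>i\<in>{1..n}. \<Sum>j\<in>{1..n} - {i}. prob (two i j))"
      by (intro sum_mono finite_measure_subadditive_finite image_subsetI ev_two) auto
    also have "\<dots> \<le> (\<Sum>i\<in>{1..n}. \<Sum>j\<in>{1..n} - {i}. q * q)"
      by (intro sum_mono two_le)
    also have "\<dots> \<le> (\<Sum>i\<in>{1..n}. \<Sum>j\<in>{1..n}. q * q)"
      by (intro sum_mono sum_mono2) auto
    also have "\<dots> = (real n * q)\<^sup>2" by (simp add: power2_eq_square)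
    finally show ?thesis .
  qed
  also have "prob zero \<le> v / x\<^sup>2"
    using prob_truncated_sum_ge_le[of "{1..n}" t x] assms by (simp add: zero_def v_def)
  also have "prob (\<Union>i\<in>{1..n}. low i \<union> mid i \<union> high i)
      \<le> real n * (q * (v / (\<delta> * x)\<^sup>2)
                    + prob {\<omega>\<in>space M. (1 - \<delta>) * x < X 1 \<omega> \<and> X 1 \<omega> \<le> x}
                    + K * x powr (- \<alpha>) * (v / (b * x)\<^sup>2))"
  proof -
    have v: "0 \<le> v" using V_pos by (simp add: v_def)
    have low_le: "prob (low i) \<le> q * (v / (\<delta> * x)\<^sup>2)" if "i \<in> {1..n}" for i
    proof -
      have "prob (low i) \<le> prob {\<omega>\<in>space M. X 1 \<omega> \<in> {u. t < \<bar>u\<bar>}} * (v / (\<delta> * x)\<^sup>2)"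
        unfolding low_def v_def using that assms by (intro prob_jump_rest_le) auto
      also have "\<dots> \<le> q * (v / (\<delta> * x)\<^sup>2)"
        using tail[OF \<open>0 < t\<close>] v by (intro mult_right_mono) (auto simp: q_def)
      finally show ?thesis .
    qed
    have mid_le: "prob (mid i) \<le> prob {\<omega>\<in>space M. (1 - \<delta>) * x < X 1 \<omega> \<and> X 1 \<omega> \<le> x}"
      if "i \<in> {1..n}" for i
      using that prob_X_eq[of i "{(1 - \<delta>) * x<..x}"] by (simp add: mid_def)
    have high_le: "prob (high i) \<le> K * x powr (- \<alpha>) * (v / (b * x)\<^sup>2)" if "i \<in> {1..n}" for i
    proof -
      have "prob (high i) \<le> prob {\<omega>\<in>space M. X 1 \<omega> \<in> {x<..}} * (v / (b * x)\<^sup>2)"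
        unfolding high_def v_def using that assms by (intro prob_jump_rest_le) auto
      also have "\<dots> \<le> K * x powr (- \<alpha>) * (v / (b * x)\<^sup>2)"
      proof (intro mult_right_mono)
        have "prob {\<omega>\<in>space M. X 1 \<omega> \<in> {x<..}} \<le> prob {\<omega>\<in>space M. x < \<bar>X 1 \<omega>\<bar>}"
          by (intro finite_measure_mono) auto
        also have "\<dots> \<le> K * x powr (- \<alpha>)" by (rule tail) fact
        finally show "prob {\<omega>\<in>space M. X 1 \<omega> \<in> {x<..}} \<le> K * x powr (- \<alpha>)" .
      qed (use v in auto)
      finally show ?thesis .
    qed
    have "prob (\<Union>i\<in>{1..n}. low i \<union> mid i \<union> high i) \<le> (\<Sum>i\<in>{1..n}. prob (low i \<union> mid i \<union> high i))"
      using ev_i by (intro finite_measure_subadditive_finite) auto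
    also have "\<dots> \<le> (\<Sum>i\<in>{1..n}. q * (v / (\<delta> * x)\<^sup>2)
                    + prob {\<omega>\<in>space M. (1 - \<delta>) * x < X 1 \<omega> \<and> X 1 \<omega> \<le> x}
                    + K * x powr (- \<alpha>) * (v / (b * x)\<^sup>2))"
      using ev_i
      by (intro sum_mono order_trans[OF measure_Un_le] add_mono low_le mid_le high_le) auto
    finally show ?thesis by simp
  qed
  finally show ?thesis by (simp add: S_def G_def)
qed

text \<open>
  The events \<open>H i\<close> that \<open>X i\<close> exceeds \<open>2 x\<close>, that no other summand does in absolute value, and that
  the others sum to less than \<open>x\<close> in absolute value are disjoint and force the sum above \<open>x\<close>.
  Only two things can keep a jump \<open>X i > 2 x\<close> from yielding \<open>H i\<close>, a second jump and a large
  rest, and the independence bounds charge each of them relative to the probability of the jump.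
\<close>

lemma prob_sum_gt_ge:
  assumes "0 < x"
  shows "real n * prob {\<omega>\<in>space M. 2 * x < X 1 \<omega>}
           * (1 - real n * (K * (2 * x) powr (- \<alpha>)) - real n * (V * (2 * x) powr (2 - \<alpha>)) / x\<^sup>2)
         \<le> prob {\<omega>\<in>space M. x < partial_sum X n \<omega>}"
proof -
  define p where "p = prob {\<omega>\<in>space M. X 1 \<omega> \<in> {2 * x<..}}"
  define q where "q = K * (2 * x) powr (- \<alpha>)"
  define w where "w = real n * (V * (2 * x) powr (2 - \<alpha>)) / x\<^sup>2"
  define H where "H i = {\<omega>\<in>space M. 2 * x < X i \<omega> \<and> (\<forall>j\<in>{1..n} - {i}. \<not> 2 * x < \<bar>X j \<omega>\<bar>)
      \<and> \<bar>rest n (2 * x) i \<omega>\<bar> < x}" for i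
  define two where "two i j = {\<omega>\<in>space M. X i \<omega> \<in> {2 * x<..} \<and> 2 * x < \<bar>X j \<omega>\<bar>}" for i j
  define off where "off i = {\<omega>\<in>space M. X i \<omega> \<in> {2 * x<..} \<and> x \<le> \<bar>rest n (2 * x) i \<omega>\<bar>}" for i
  have meas [measurable]: "random_variable borel (X j)" if "j \<in> {1..n}" for j
    using that by (intro X_measurable) auto
  have rest_meas [measurable]: "random_variable borel (rest n (2 * x) i)" for i
    using X_measurable by (intro borel_measurable_sum measurable_compose[OF _ truncate_measurable]) auto
  have ev_two: "two i j \<in> events" if "i \<in> {1..n}" "j \<in> {1..n} - {i}" for i j
  proof -
    have [measurable]: "random_variable borel (X i)" "random_variable borel (X j)"
      using that by auto
    show ?thesis unfolding two_def by measurable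
  qed
  have ev_off: "off i \<in> events" if "i \<in> {1..n}" for i
  proof -
    note [measurable] = meas[OF that]
    show ?thesis unfolding off_def by measurable
  qed
  have ev_H: "H i \<in> events" if i: "i \<in> {1..n}" for i
  proof -
    note [measurable] = meas[OF i]
    have "{\<omega>\<in>space M. \<not> 2 * x < \<bar>X j \<omega>\<bar>} \<in> events" if "j \<in> {1..n} - {i}" for j
    proof -
      have [measurable]: "random_variable borel (X j)" using that by auto
      show ?thesis by measurable
    qed
    then have [measurable]: "{\<omega>\<in>space M. \<forall>j\<in>{1..n} - {i}. \<not> 2 * x < \<bar>X j \<omega>\<bar>} \<in> events"
      by (intro sets.sets_Collect_finite_All) auto
    have "H i = {\<omega>\<in>space M. 2 * x < X i \<omega> \<and> \<bar>rest n (2 * x) i \<omega>\<bar> < x}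
        \<inter> {\<omega>\<in>space M. \<forall>j\<in>{1..n} - {i}. \<not> 2 * x < \<bar>X j \<omega>\<bar>}"
      by (auto simp: H_def)
    also have "\<dots> \<in> events" by measurable
    finally show ?thesis .
  qed
  have H_ge: "p * (1 - real n * q - w) \<le> prob (H i)" if i: "i \<in> {1..n}" for i
  proof -
    note [measurable] = meas[OF i]
    have "p = prob {\<omega>\<in>space M. X i \<omega> \<in> {2 * x<..}}"
      using i unfolding p_def by (intro prob_X_eq[symmetric]) auto
    also have "\<dots> \<le> prob (H i \<union> ((\<Union>j\<in>{1..n} - {i}. two i j) \<union> off i))"
      using ev_H[OF i] ev_two[OF i] ev_off[OF i]
      by (intro finite_measure_mono sets.Un sets.finite_UN) (auto simp: H_def two_def off_def)
    also have "\<dots> \<le> prob (H i) + (prob (\<Union>j\<in>{1..n} - {i}. two i j) + prob (off i))"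
      using ev_H[OF i] ev_two[OF i] ev_off[OF i]
      by (intro order_trans[OF measure_Un_le] add_mono order_refl sets.Un sets.finite_UN) auto
    also have "prob (\<Union>j\<in>{1..n} - {i}. two i j) \<le> (\<Sum>j\<in>{1..n} - {i}. prob (two i j))"
      by (intro finite_measure_subadditive_finite image_subsetI ev_two i) auto
    also have "\<dots> \<le> (\<Sum>j\<in>{1..n} - {i}. p * q)"
      unfolding two_def p_def q_def using assms i by (intro sum_mono prob_two_jumps_le) auto
    also have "\<dots> \<le> (\<Sum>j\<in>{1..n}. p * q)"
      using K_pos by (intro sum_mono2) (auto simp: p_def q_def)
    also have "prob (off i) \<le> p * w"
      unfolding off_def p_def w_def using assms i by (intro prob_jump_rest_le) auto
    finally show ?thesis by (simp add: algebra_simps)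
  qed
  have "real n * (p * (1 - real n * q - w)) = (\<Sum>i\<in>{1..n}. p * (1 - real n * q - w))" by simp
  also have "\<dots> \<le> (\<Sum>i\<in>{1..n}. prob (H i))" by (intro sum_mono H_ge)
  also have "\<dots> = prob (\<Union>i\<in>{1..n}. H i)"
  proof (rule finite_measure_finite_Union[symmetric])
    show "disjoint_family_on H {1..n}"
      unfolding disjoint_family_on_def
    proof (intro ballI impI)
      fix i j assume "i \<in> {1..n}" "j \<in> {1..n}" "i \<noteq> j"
      then have j: "j \<in> {1..n} - {i}" by simp
      show "H i \<inter> H j = {}"
      proof (rule equals0I)
        fix \<omega> assume "\<omega> \<in> H i \<inter> H j"
        then have "2 * x < X j \<omega>" and "\<not> 2 * x < \<bar>X j \<omega>\<bar>"
          using j unfolding H_def by blast+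
        then show False by linarith
      qed
    qed
  qed (use ev_H in auto)
  also have "\<dots> \<le> prob {\<omega>\<in>space M. x < partial_sum X n \<omega>}"
  proof (rule finite_measure_mono)
    show "(\<Union>i\<in>{1..n}. H i) \<subseteq> {\<omega>\<in>space M. x < partial_sum X n \<omega>}"
    proof
      fix \<omega> assume "\<omega> \<in> (\<Union>i\<in>{1..n}. H i)"
      then obtain i where i: "i \<in> {1..n}" and H: "\<omega> \<in> H i" by blast
      have "rest n (2 * x) i \<omega> = partial_sum X n \<omega> - X i \<omega>"
        using H unfolding H_def not_less by (intro rest_eq i) blast
      then show "\<omega> \<in> {\<omega>\<in>space M. x < partial_sum X n \<omega>}"
        using H by (auto simp: H_def)
    qed
  qed measurable
  finally show ?thesis by (simp add: p_def q_def w_def mult.assoc)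
qed

end

section \<open>The rate of the large deviation and the asymptotic equivalence\<close>

context symmetric_power_tail
begin

text \<open>
  The bound of \<open>prob_sum_gt_le_big_jump\<close> at the level \<open>t = min c \<eta> * x\<close>, written as a multiple of
  \<open>r\<close>. The first two terms of the factor tend to \<open>0\<close> when \<open>r << 1\<close>, \<open>r << c\<^bsup>2\<alpha>\<^esup>\<close> and
  \<open>r << b\<^sup>2 c\<^bsup>\<alpha>-2\<^esup>\<close>, and the last two become small with the parameters \<open>\<eta>\<close> and \<open>\<delta>\<close>.
\<close>

lemma prob_sum_gt_le_rate:
  fixes n :: nat and x c b \<delta> \<eta> D :: real
  assumes "0 < x" "0 < c" "c < 1" "0 < b" "0 < \<delta>" "0 < \<eta>"
    and window: "prob {\<omega>\<in>space M. (1 - \<delta>) * x < X 1 \<omega> \<and> X 1 \<omega> \<le> x} \<le> D * \<delta> * x powr (- \<alpha>)"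
  defines "r \<equiv> real n * x powr (- \<alpha>)"
  shows "prob {\<omega>\<in>space M. x < partial_sum X n \<omega>}
      \<le> prob ({\<omega>\<in>space M. x < partial_sum X n \<omega>} \<inter> (\<Union>i\<in>{1..n}. one_big_jump M X n x c b i))
        + ((K\<^sup>2 + K * V / \<delta>\<^sup>2) * (r / c powr (2 * \<alpha>) + r / \<eta> powr (2 * \<alpha>))
           + K * V * (r / (b\<^sup>2 * c powr (\<alpha> - 2))) + V * \<eta> powr (2 - \<alpha>) + D * \<delta>) * r"
proof -
  define m where "m = min c \<eta>"
  have m: "0 < m" "m \<le> c" "m \<le> \<eta>" "m \<le> 1" using assms by (auto simp: m_def)
  define y where "y = x powr (- \<alpha>)"
  have y: "0 < y" using assms by (simp add: y_def)
  have r: "r = real n * y" by (simp add: r_def y_def)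
  have r_nonneg: "0 \<le> r" using y by (simp add: r)
  define q where "q = K * (m * x) powr (- \<alpha>)"
  define v where "v = real n * (V * (m * x) powr (2 - \<alpha>))"
  have q: "q = K * m powr (- \<alpha>) * y"
    using m \<open>0 < x\<close> by (simp add: q_def y_def powr_mult)
  have x2: "x powr (2 - \<alpha>) = x\<^sup>2 * y"
    using assms powr_add[of x 2 "- \<alpha>"] by (simp add: y_def)
  have v: "v = V * m powr (2 - \<alpha>) * r * x\<^sup>2"
    using m \<open>0 < x\<close> by (simp add: v_def r powr_mult x2)
  have m_sq: "(m powr (- \<alpha>))\<^sup>2 = m powr (- (2 * \<alpha>))"
    using m powr_add[of m "- \<alpha>" "- \<alpha>"] by (simp add: power2_eq_square)
  define \<rho> where "\<rho> = r / c powr (2 * \<alpha>) + r / \<eta> powr (2 * \<alpha>)"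
  \<comment> \<open>The minimum \<open>m\<close> is \<open>c\<close> or \<open>\<eta>\<close>; adding both terms avoids distinguishing the cases later on.\<close>
  have \<rho>: "m powr (- (2 * \<alpha>)) * r \<le> \<rho>"
  proof (cases "c \<le> \<eta>")
    case True
    then have "m powr (- (2 * \<alpha>)) * r = r / c powr (2 * \<alpha>)" by (simp add: m_def powr_minus_divide)
    then show ?thesis using r_nonneg by (simp add: \<rho>_def)
  next
    case False
    then have "m powr (- (2 * \<alpha>)) * r = r / \<eta> powr (2 * \<alpha>)" by (simp add: m_def powr_minus_divide)
    then show ?thesis using r_nonneg by (simp add: \<rho>_def)
  qed
  have "prob {\<omega>\<in>space M. x < partial_sum X n \<omega>}
      \<le> prob ({\<omega>\<in>space M. x < partial_sum X n \<omega>} \<inter> (\<Union>i\<in>{1..n}. one_big_jump M X n x c b i))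
        + ((real n * q)\<^sup>2 + v / x\<^sup>2
        + real n * (q * (v / (\<delta> * x)\<^sup>2)
                    + prob {\<omega>\<in>space M. (1 - \<delta>) * x < X 1 \<omega> \<and> X 1 \<omega> \<le> x}
                    + K * x powr (- \<alpha>) * (v / (b * x)\<^sup>2)))"
    unfolding q_def v_def using assms m by (intro prob_sum_gt_le_big_jump) auto
  also have "\<dots> \<le> prob ({\<omega>\<in>space M. x < partial_sum X n \<omega>} \<inter> (\<Union>i\<in>{1..n}. one_big_jump M X n x c b i))
        + ((real n * q)\<^sup>2 + v / x\<^sup>2
        + real n * (q * (v / (\<delta> * x)\<^sup>2) + D * \<delta> * y + K * y * (v / (b * x)\<^sup>2)))"
    unfolding y_def by (intro add_left_mono mult_left_mono add_mono window order_refl) auto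
  also have "(real n * q)\<^sup>2 \<le> K\<^sup>2 * \<rho> * r"
  proof -
    have "(real n * q)\<^sup>2 = K\<^sup>2 * (m powr (- (2 * \<alpha>)) * r) * r"
      unfolding m_sq[symmetric] by (simp add: q r power2_eq_square ac_simps)
    also have "\<dots> \<le> K\<^sup>2 * \<rho> * r" using \<rho> r_nonneg by (intro mult_left_mono mult_right_mono) auto
    finally show ?thesis .
  qed
  also have "v / x\<^sup>2 \<le> V * \<eta> powr (2 - \<alpha>) * r"
  proof -
    have "v / x\<^sup>2 = V * m powr (2 - \<alpha>) * r" using \<open>0 < x\<close> by (simp add: v)
    also have "\<dots> \<le> V * \<eta> powr (2 - \<alpha>) * r"
      using m alpha V_pos r_nonneg by (intro mult_left_mono mult_right_mono powr_mono2) auto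
    finally show ?thesis .
  qed
  also have "real n * (q * (v / (\<delta> * x)\<^sup>2) + D * \<delta> * y + K * y * (v / (b * x)\<^sup>2))
      \<le> (K * V / \<delta>\<^sup>2 * \<rho> + D * \<delta> + K * V * (r / (b\<^sup>2 * c powr (\<alpha> - 2)))) * r"
  proof -
    \<comment> \<open>As \<open>m \<le> 1\<close>, the exponent \<open>2 - 2 \<alpha>\<close> is bounded by the exponent \<open>- 2 \<alpha>\<close> of two jumps.\<close>
    have "m powr (- \<alpha>) * m powr (2 - \<alpha>) = m\<^sup>2 * m powr (- (2 * \<alpha>))"
      using m powr_add[of m "- \<alpha>" "2 - \<alpha>"] powr_add[of m 2 "- (2 * \<alpha>)"] by simp
    then have "m powr (- \<alpha>) * m powr (2 - \<alpha>) * r = m\<^sup>2 * (m powr (- (2 * \<alpha>)) * r)" by simp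
    also have "\<dots> \<le> 1 * \<rho>"
      using m \<rho> r_nonneg by (intro mult_mono) (auto simp: power_le_one)
    finally have m_le: "m powr (- \<alpha>) * m powr (2 - \<alpha>) * r \<le> \<rho>" by simp
    have "real n * (q * (v / (\<delta> * x)\<^sup>2)) = K * V / \<delta>\<^sup>2 * (m powr (- \<alpha>) * m powr (2 - \<alpha>) * r) * r"
      using \<open>0 < x\<close> by (simp add: q v r power_mult_distrib ac_simps)
    also have "\<dots> \<le> K * V / \<delta>\<^sup>2 * \<rho> * r"
      using m_le r_nonneg K_pos V_pos by (intro mult_right_mono mult_left_mono) auto
    finally have low: "real n * (q * (v / (\<delta> * x)\<^sup>2)) \<le> K * V / \<delta>\<^sup>2 * \<rho> * r" .
    have "m powr (2 - \<alpha>) \<le> c powr (2 - \<alpha>)"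
      using m alpha by (intro powr_mono2) auto
    also have "\<dots> = 1 / c powr (\<alpha> - 2)"
      using powr_minus_divide[of c "\<alpha> - 2"] by simp
    finally have c_le: "m powr (2 - \<alpha>) \<le> 1 / c powr (\<alpha> - 2)" .
    have "real n * (K * y * (v / (b * x)\<^sup>2)) = K * V * (r / b\<^sup>2 * m powr (2 - \<alpha>)) * r"
      using \<open>0 < x\<close> by (simp add: v r power_mult_distrib ac_simps)
    also have "\<dots> \<le> K * V * (r / b\<^sup>2 * (1 / c powr (\<alpha> - 2))) * r"
      using c_le r_nonneg K_pos V_pos by (intro mult_right_mono mult_left_mono) auto
    finally have high: "real n * (K * y * (v / (b * x)\<^sup>2)) \<le> K * V * (r / (b\<^sup>2 * c powr (\<alpha> - 2))) * r"
      by simp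
    show ?thesis using low high by (simp add: distrib_left distrib_right r ac_simps)
  qed
  finally show ?thesis by (simp add: \<rho>_def distrib_left distrib_right ac_simps)
qed

lemma prob_sum_gt_ge_rate:
  fixes n :: nat and x A :: real
  assumes "0 < x" and jump: "A * x powr (- \<alpha>) \<le> prob {\<omega>\<in>space M. 2 * x < X 1 \<omega>}"
    and small: "(K * 2 powr (- \<alpha>) + V * 2 powr (2 - \<alpha>)) * (real n * x powr (- \<alpha>)) \<le> 1 / 2"
  shows "A / 2 * (real n * x powr (- \<alpha>)) \<le> prob {\<omega>\<in>space M. x < partial_sum X n \<omega>}"
proof -
  have x2: "x powr (2 - \<alpha>) = x\<^sup>2 * x powr (- \<alpha>)"
    using assms powr_add[of x 2 "- \<alpha>"] by simp
  have "real n * (K * (2 * x) powr (- \<alpha>)) + real n * (V * (2 * x) powr (2 - \<alpha>)) / x\<^sup>2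
      = (K * 2 powr (- \<alpha>) + V * 2 powr (2 - \<alpha>)) * (real n * x powr (- \<alpha>))"
    using assms by (simp add: powr_mult x2 distrib_left distrib_right ac_simps)
  with small have half: "1 / 2 \<le> 1 - real n * (K * (2 * x) powr (- \<alpha>)) - real n * (V * (2 * x) powr (2 - \<alpha>)) / x\<^sup>2"
    by linarith
  have "A / 2 * (real n * x powr (- \<alpha>)) = real n * (A * x powr (- \<alpha>)) * (1 / 2)" by simp
  also have "\<dots> \<le> real n * prob {\<omega>\<in>space M. 2 * x < X 1 \<omega>}
      * (1 - real n * (K * (2 * x) powr (- \<alpha>)) - real n * (V * (2 * x) powr (2 - \<alpha>)) / x\<^sup>2)"
    using jump half by (intro mult_mono mult_left_mono) auto
  also have "\<dots> \<le> prob {\<omega>\<in>space M. x < partial_sum X n \<omega>}"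
    by (rule prob_sum_gt_ge) fact
  finally show ?thesis .
qed

text \<open>
  The difference of the two probabilities is compared with \<open>\<theta> r\<close>, where \<open>\<theta> = \<epsilon> A / 2\<close>: since
  \<open>A / 2 * r\<close> is eventually a lower bound for \<open>P(S\<^sub>n > x)\<close>, this is an error of relative size \<open>\<epsilon>\<close>.
  The window and the case of no jump may each use a quarter of \<open>\<theta>\<close>, which fixes \<open>\<delta>\<close>
  and \<open>\<eta>\<close>; the terms collected in \<open>E\<close> tend to \<open>0\<close> and use the other half.
\<close>

lemma one_big_jump_asymp_equiv:
  fixes n :: "nat \<Rightarrow> nat" and x c b :: "nat \<Rightarrow> real" and A D u\<^sub>0 :: real
  assumes "0 < A" "0 < D" "0 < u\<^sub>0"
    and jump: "\<And>x. u\<^sub>0 \<le> x \<Longrightarrow> A * x powr (- \<alpha>) \<le> prob {\<omega>\<in>space M. 2 * x < X 1 \<omega>}"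
    and window: "\<And>x \<delta>. u\<^sub>0 \<le> x \<Longrightarrow> 0 < \<delta> \<Longrightarrow> \<delta> \<le> 1 / 2 \<Longrightarrow>
      prob {\<omega>\<in>space M. (1 - \<delta>) * x < X 1 \<omega> \<and> X 1 \<omega> \<le> x} \<le> D * \<delta> * x powr (- \<alpha>)"
    and n: "\<And>k. 1 \<le> n k" and x: "\<And>k. 0 < x k"
    and c: "\<And>k. 0 < c k \<and> c k < 1" and b: "\<And>k. 0 < b k \<and> b k < 1"
    and o1: "(\<lambda>k. real (n k)) \<in> o[sequentially](\<lambda>k. x k powr \<alpha>)"
    and o2: "(\<lambda>k. real (n k) * x k powr (- \<alpha>)) \<in> o[sequentially](\<lambda>k. c k powr (2 * \<alpha>))"
    and o3: "(\<lambda>k. real (n k) * x k powr (- \<alpha>)) \<in> o[sequentially](\<lambda>k. (b k)\<^sup>2 * c k powr (\<alpha> - 2))"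
  shows "(\<lambda>k. prob {\<omega>\<in>space M. x k < partial_sum X (n k) \<omega>}) \<sim>[sequentially]
      (\<lambda>k. prob ({\<omega>\<in>space M. x k < partial_sum X (n k) \<omega>}
             \<inter> (\<Union>i\<in>{1..n k}. one_big_jump M X (n k) (x k) (c k) (b k) i)))"
    (is "?P \<sim>[sequentially] ?Q")
proof -
  define r where "r k = real (n k) * x k powr (- \<alpha>)" for k
  have r_nonneg: "0 \<le> r k" for k by (simp add: r_def)
  have r_lim: "r \<longlonglongrightarrow> 0"
    using smalloD_tendsto[OF o1] by (simp add: r_def[abs_def] powr_minus_divide)
  have c_lim: "(\<lambda>k. r k / c k powr (2 * \<alpha>)) \<longlonglongrightarrow> 0"
    using smalloD_tendsto[OF o2] by (simp add: r_def)
  have b_lim: "(\<lambda>k. r k / ((b k)\<^sup>2 * c k powr (\<alpha> - 2))) \<longlonglongrightarrow> 0"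
    using smalloD_tendsto[OF o3] by (simp add: r_def)
  \<comment> \<open>As \<open>n \<ge> 1\<close>, \<open>r\<close> can tend to \<open>0\<close> only if \<open>x\<close> tends to infinity.\<close>
  have large: "eventually (\<lambda>k. u\<^sub>0 \<le> x k) sequentially"
  proof -
    have "eventually (\<lambda>k. r k < u\<^sub>0 powr (- \<alpha>)) sequentially"
      using order_tendstoD(2)[OF r_lim] \<open>0 < u\<^sub>0\<close> by simp
    then show ?thesis
    proof eventually_elim
      case (elim k)
      have "1 * x k powr (- \<alpha>) \<le> r k"
        unfolding r_def using n[of k] by (intro mult_right_mono) auto
      with elim have lt: "x k powr (- \<alpha>) < u\<^sub>0 powr (- \<alpha>)" by simp
      show ?case
      proof (rule ccontr)
        assume "\<not> u\<^sub>0 \<le> x k"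
        then have "u\<^sub>0 powr (- \<alpha>) \<le> x k powr (- \<alpha>)"
          using x[of k] alpha by (intro powr_mono2') auto
        with lt show False by simp
      qed
    qed
  qed
  have lower: "eventually (\<lambda>k. A / 2 * r k \<le> ?P k) sequentially"
  proof -
    have "(\<lambda>k. (K * 2 powr (- \<alpha>) + V * 2 powr (2 - \<alpha>)) * r k) \<longlonglongrightarrow> 0"
      using tendsto_mult_right_zero[OF r_lim] .
    then have "eventually (\<lambda>k. (K * 2 powr (- \<alpha>) + V * 2 powr (2 - \<alpha>)) * r k < 1 / 2) sequentially"
      by (rule order_tendstoD) simp
    with large show ?thesis
    proof eventually_elim
      case (elim k)
      then show ?case
        unfolding r_def using x[of k] by (intro prob_sum_gt_ge_rate jump) auto
    qed
  qed
  have "(\<lambda>k. ?Q k - ?P k) \<in> o[sequentially](?P)"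
  proof (rule landau_o.smallI)
    fix \<epsilon> :: real assume "0 < \<epsilon>"
    define \<theta> where "\<theta> = A / 2 * \<epsilon>"
    have \<theta>: "0 < \<theta>" using \<open>0 < A\<close> \<open>0 < \<epsilon>\<close> by (simp add: \<theta>_def)
    define \<delta> where "\<delta> = min (1 / 2) (\<theta> / 4 / D)"
    define \<eta> where "\<eta> = (\<theta> / 4 / V) powr (1 / (2 - \<alpha>))"
    have \<delta>: "0 < \<delta>" "\<delta> \<le> 1 / 2" "\<delta> \<le> \<theta> / 4 / D"
      using \<theta> \<open>0 < D\<close> by (auto simp: \<delta>_def)
    have D\<delta>: "D * \<delta> \<le> \<theta> / 4"
      using mult_left_mono[OF \<delta>(3), of D] \<open>0 < D\<close> by simp
    have \<eta>: "0 < \<eta>" "V * \<eta> powr (2 - \<alpha>) \<le> \<theta> / 4"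
      using \<theta> V_pos alpha by (auto simp: \<eta>_def powr_powr)
    define E where "E k = (K\<^sup>2 + K * V / \<delta>\<^sup>2) * (r k / c k powr (2 * \<alpha>) + r k / \<eta> powr (2 * \<alpha>))
           + K * V * (r k / ((b k)\<^sup>2 * c k powr (\<alpha> - 2)))" for k
    have "E \<longlonglongrightarrow> (K\<^sup>2 + K * V / \<delta>\<^sup>2) * (0 + 0 / \<eta> powr (2 * \<alpha>)) + K * V * 0"
      unfolding E_def[abs_def] using \<eta>(1)
      by (intro tendsto_intros c_lim b_lim r_lim) auto
    then have "eventually (\<lambda>k. E k < \<theta> / 2) sequentially"
      using \<theta> by (intro order_tendstoD(2)) auto
    with large lower show "eventually (\<lambda>k. norm (?Q k - ?P k) \<le> \<epsilon> * norm (?P k)) sequentially"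
    proof eventually_elim
      case (elim k)
      have "?P k \<le> ?Q k + (E k + V * \<eta> powr (2 - \<alpha>) + D * \<delta>) * r k"
        unfolding E_def r_def
        using x[of k] c[of k] b[of k] \<delta> \<eta> elim(1) by (intro prob_sum_gt_le_rate window) auto
      also have "(E k + V * \<eta> powr (2 - \<alpha>) + D * \<delta>) * r k \<le> \<theta> * r k"
        using elim(3) D\<delta> \<eta> r_nonneg by (intro mult_right_mono) auto
      also have "\<dots> = \<epsilon> * (A / 2 * r k)" by (simp add: \<theta>_def)
      also have "\<dots> \<le> \<epsilon> * ?P k"
        using elim(2) \<open>0 < \<epsilon>\<close> by (intro mult_left_mono) auto
      finally have "?P k \<le> ?Q k + \<epsilon> * ?P k" by simp
      moreover have "?Q k \<le> ?P k"
        by (intro finite_measure_mono) auto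
      ultimately show ?case by simp
    qed
  qed
  then have "?Q \<sim>[sequentially] ?P" by (simp add: asymp_equiv_altdef)
  then show ?thesis by (rule asymp_equiv_symI)
qed

end

text \<open>
  Below \<open>u\<^sub>0\<close> nothing is known about the density, but there \<open>1 \<le> u\<^sub>0\<^bsup>a\<^esup> t\<^bsup>-a\<^esup>\<close>, so the second
  summand of the constant makes the bound hold for every \<open>t > 0\<close>.
\<close>

lemma (in prob_space) symmetric_tail_le_of_density_le:
  fixes f :: "real \<Rightarrow> real"
  assumes X: "distributed M lborel X (\<lambda>u. ennreal (f u))"
    and symmetric: "distr M borel (\<lambda>\<omega>. - X \<omega>) = distr M borel X"
    and f: "\<And>u. u\<^sub>0 \<le> u \<Longrightarrow> f u \<le> B * u powr (- 1 - a)"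
    and "0 < a" "0 \<le> B" "0 < u\<^sub>0" "0 < t"
  shows "prob {\<omega>\<in>space M. t < \<bar>X \<omega>\<bar>} \<le> (2 * (B / a) + u\<^sub>0 powr a) * t powr (- a)"
proof (cases "u\<^sub>0 \<le> t")
  case True
  have [measurable]: "random_variable borel X"
    using distributed_measurable[OF X] by simp
  have "prob {\<omega>\<in>space M. t \<le> - X \<omega>} = measure (distr M borel (\<lambda>\<omega>. - X \<omega>)) {t..}"
    by (subst measure_distr) (auto intro!: arg_cong[where f = prob])
  also have "\<dots> = prob {\<omega>\<in>space M. t \<le> X \<omega>}"
    unfolding symmetric by (subst measure_distr) (auto intro!: arg_cong[where f = prob])
  finally have neg: "prob {\<omega>\<in>space M. t \<le> - X \<omega>} = prob {\<omega>\<in>space M. t \<le> X \<omega>}" .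
  have "prob {\<omega>\<in>space M. t < \<bar>X \<omega>\<bar>} \<le> prob ({\<omega>\<in>space M. t \<le> X \<omega>} \<union> {\<omega>\<in>space M. t \<le> - X \<omega>})"
    by (intro finite_measure_mono) auto
  also have "\<dots> \<le> prob {\<omega>\<in>space M. t \<le> X \<omega>} + prob {\<omega>\<in>space M. t \<le> - X \<omega>}"
    by (intro measure_Un_le) auto
  also have "\<dots> = 2 * prob {\<omega>\<in>space M. t \<le> X \<omega>}" by (simp add: neg)
  also have "\<dots> \<le> 2 * (B / a * t powr (- a))"
    using prob_tail_le_of_density_le[OF X f] assms True by (intro mult_left_mono) auto
  also have "\<dots> = 2 * (B / a) * t powr (- a)" by simp
  also have "\<dots> \<le> (2 * (B / a) + u\<^sub>0 powr a) * t powr (- a)"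
    by (intro mult_right_mono) auto
  finally show ?thesis .
next
  case False
  have "prob {\<omega>\<in>space M. t < \<bar>X \<omega>\<bar>} \<le> t powr a * t powr (- a)"
    using \<open>0 < t\<close> powr_add[of t a "- a"] by simp
  also have "\<dots> \<le> (2 * (B / a) + u\<^sub>0 powr a) * t powr (- a)"
    using False assms by (intro mult_right_mono add_increasing powr_mono2) auto
  finally show ?thesis .
qed

theorem theorem1:
  fixes M :: "'a measure" and X :: "nat \<Rightarrow> 'a \<Rightarrow> real" and f :: "real \<Rightarrow> real"
    and \<alpha> :: real and n :: "nat \<Rightarrow> nat" and x c b :: "nat \<Rightarrow> real"
  assumes "0 < \<alpha>" and "\<alpha> < 2"
    and "prob_space M"
    and "prob_space.indep_vars M (\<lambda>_. borel) X {1..}"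
    and "\<And>i. i \<ge> 1 \<Longrightarrow> distr M borel (X i) = distr M borel (X 1)"
    and "distr M borel (\<lambda>\<omega>. - X 1 \<omega>) = distr M borel (X 1)"
    and "\<And>u. f u \<ge> 0"
    and "distributed M lborel (X 1) (\<lambda>u. ennreal (f u))"
    and "f \<in> \<Theta>[at_top](\<lambda>u. u powr (- 1 - \<alpha>))"
    and "\<And>k. n k \<ge> 1" and "\<And>k. x k > 0"
    and "\<And>k. 0 < c k \<and> c k < 1" and "\<And>k. 0 < b k \<and> b k < 1"
    and "(\<lambda>k. real (n k)) \<in> o[sequentially](\<lambda>k. x k powr \<alpha>)"
    and "(\<lambda>k. real (n k) * x k powr (- \<alpha>)) \<in> o[sequentially](\<lambda>k. c k powr (2 * \<alpha>))"
    and "(\<lambda>k. real (n k) * x k powr (- \<alpha>))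
           \<in> o[sequentially](\<lambda>k. (b k)\<^sup>2 * c k powr (\<alpha> - 2))"
  shows "(\<lambda>k. measure M {\<omega> \<in> space M. partial_sum X (n k) \<omega> > x k})
    \<sim>[sequentially]
      (\<lambda>k. measure M ({\<omega> \<in> space M. partial_sum X (n k) \<omega> > x k}
             \<inter> (\<Union>i\<in>{1..n k}. one_big_jump M X (n k) (x k) (c k) (b k) i)))"
proof -
  interpret prob_space M by fact
  note X_density = \<open>distributed M lborel (X 1) (\<lambda>u. ennreal (f u))\<close>
  obtain A B u\<^sub>0 where AB: "0 < A" "0 < B" and u\<^sub>0: "0 < u\<^sub>0"
    and f_ge: "\<And>u. u\<^sub>0 \<le> u \<Longrightarrow> A * u powr (- 1 - \<alpha>) \<le> f u"
    and f_le: "\<And>u. u\<^sub>0 \<le> u \<Longrightarrow> f u \<le> B * u powr (- 1 - \<alpha>)"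
  proof -
    obtain B where B: "0 < B" "eventually (\<lambda>u. norm (f u) \<le> B * norm (u powr (- 1 - \<alpha>))) at_top"
      using bigthetaD1[OF \<open>f \<in> \<Theta>[at_top](\<lambda>u. u powr (- 1 - \<alpha>))\<close>] by (elim landau_o.bigE)
    obtain C where C: "0 < C" "eventually (\<lambda>u. norm (u powr (- 1 - \<alpha>)) \<le> C * norm (f u)) at_top"
      using bigthetaD2[OF \<open>f \<in> \<Theta>[at_top](\<lambda>u. u powr (- 1 - \<alpha>))\<close>]
      by (auto simp: bigomega_iff_bigo elim: landau_o.bigE)
    from eventually_conj[OF B(2) C(2)]
    obtain N where N: "norm (f u) \<le> B * norm (u powr (- 1 - \<alpha>)) \<and> norm (u powr (- 1 - \<alpha>)) \<le> C * norm (f u)"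
      if "N \<le> u" for u by (auto simp: eventually_at_top_linorder)
    show thesis
    proof (rule that[of "1 / C" B "max N 1"])
      fix u :: real assume "max N 1 \<le> u"
      with N[of u] \<open>\<And>u. 0 \<le> f u\<close> C(1)
      show "1 / C * u powr (- 1 - \<alpha>) \<le> f u" "f u \<le> B * u powr (- 1 - \<alpha>)"
        by (simp_all add: field_simps)
    qed (use B C in auto)
  qed
  have K_pos: "0 < 2 * (B / \<alpha>) + u\<^sub>0 powr \<alpha>"
    using AB u\<^sub>0 \<open>0 < \<alpha>\<close> by (intro add_nonneg_pos) auto
  interpret symmetric_power_tail M X \<alpha> "2 * (B / \<alpha>) + u\<^sub>0 powr \<alpha>"
  proof
    show "0 < \<alpha>" "\<alpha> < 2" "0 < 2 * (B / \<alpha>) + u\<^sub>0 powr \<alpha>" by fact+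
    show "indep_vars (\<lambda>_. borel) X {1..}" by fact
    show "distr M borel (X i) = distr M borel (X 1)" if "1 \<le> i" for i
      using that by (rule assms(5))
    show "distr M borel (\<lambda>\<omega>. - X 1 \<omega>) = distr M borel (X 1)" by fact
    show "prob {\<omega>\<in>space M. t < \<bar>X 1 \<omega>\<bar>} \<le> (2 * (B / \<alpha>) + u\<^sub>0 powr \<alpha>) * t powr (- \<alpha>)" if "0 < t" for t
      using AB u\<^sub>0 that assms(1)
      by (intro symmetric_tail_le_of_density_le[OF X_density assms(6) f_le]) auto
  qed
  show ?thesis
  proof (rule one_big_jump_asymp_equiv[where A = "A / \<alpha> * 3 powr (- \<alpha>)" and D = "B * 2 powr (1 + \<alpha>)" and u\<^sub>0 = "2 * u\<^sub>0",
        OF _ _ _ _ _ assms(10-16)])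
    fix y :: real assume y: "2 * u\<^sub>0 \<le> y"
    \<comment> \<open>Any level beyond \<open>2 y\<close> passes from the closed tail to the open one; hence the factor \<open>3\<close>.\<close>
    have "A / \<alpha> * 3 powr (- \<alpha>) * y powr (- \<alpha>) = A / \<alpha> * (3 * y) powr (- \<alpha>)"
      using y u\<^sub>0 by (simp add: powr_mult)
    also have "\<dots> \<le> prob {\<omega>\<in>space M. 3 * y \<le> X 1 \<omega>}"
      using y u\<^sub>0 AB assms(1) by (intro prob_tail_ge_of_density_ge[OF X_density f_ge]) auto
    also have "\<dots> \<le> prob {\<omega>\<in>space M. 2 * y < X 1 \<omega>}"
      using y u\<^sub>0 by (intro finite_measure_mono) auto
    finally show "A / \<alpha> * 3 powr (- \<alpha>) * y powr (- \<alpha>) \<le> prob {\<omega>\<in>space M. 2 * y < X 1 \<omega>}" .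
    show "prob {\<omega>\<in>space M. (1 - \<delta>) * y < X 1 \<omega> \<and> X 1 \<omega> \<le> y} \<le> B * 2 powr (1 + \<alpha>) * \<delta> * y powr (- \<alpha>)"
      if "0 < \<delta>" "\<delta> \<le> 1 / 2" for \<delta>
      using that y u\<^sub>0 AB assms(1) by (intro prob_window_le_of_density_le[OF X_density f_le]) auto
  qed (use assms(1) AB u\<^sub>0 in auto)
qed

end
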